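(* For every integer $n\ge 0$, $$P_{n+1}=\frac12\sum_{i=0}^{n}\left(-\frac12\right)^{n-i}P_{i+2}=\frac15\sum_{i=0}^{n}\left(-\frac25\right)^{n-i}P_{i+3}=\frac1{12}\sum_{i=0}^{n}\left(-\frac5{12}\right)^{n-i}P_{i+4}.$$
   Context: $P_n$ denotes the Pell numbers: $P_0=0$, $P_1=1$, $P_n=2P_{n-1}+P_{n-2}$. *)

theory Defs
  imports Complex_Main
begin

fun pell :: "nat \<Rightarrow> nat" where
  "pell 0 = 0"
| "pell (Suc 0) = 1"
| "pell (Suc (Suc n)) = 2 * pell (Suc n) + pell n"

end

theory Submission
  imports Defs
begin

text \<open>
  The three sums are the cases \<open>k = 1, 2, 3\<close> of one identity,
  \<open>P(n+1) = 1/P(k+1) * (\<Sum>i\<le>n. (- P(k)/P(k+1))^(n-i) * P(i+k+1))\<close>.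
  It is the solution by variation of constants of a first-order linear recurrence: the addition
  formula \<open>P(m+k+1) = P(k+1) * P(m+1) + P(k) * P(m)\<close>, divided by \<open>P(k+1)\<close>, expresses
  \<open>P(m+1)\<close> as \<open>- P(k)/P(k+1)\<close> times \<open>P(m)\<close> plus the inhomogeneous term
  \<open>P(m+k+1)/P(k+1)\<close>. Since \<open>P(0) = 0\<close>, the solution has no homogeneous part.
\<close>

lemma pell_add: "pell (m + k + 1) = pell (k + 1) * pell (m + 1) + pell k * pell m"
  by (induction m rule: pell.induct) (auto simp: algebra_simps)

lemma pell_Suc_pos: "pell (Suc k) > 0"
  by (induction k) auto

lemma linear_recurrence_solution:
  fixes f g :: "nat \<Rightarrow> 'a :: comm_ring_1"
  assumes "f 0 = g 0" and "\<And>n. f (Suc n) = r * f n + g (Suc n)"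
  shows "f n = (\<Sum>i=0..n. r ^ (n - i) * g i)"
proof (induction n)
  case 0
  show ?case using assms(1) by simp
next
  case (Suc n)
  have "r * (\<Sum>i=0..n. r ^ (n - i) * g i) = (\<Sum>i=0..n. r ^ (Suc n - i) * g i)"
    unfolding sum_distrib_left by (rule sum.cong) (auto simp: Suc_diff_le mult.assoc)
  then show ?case using Suc assms(2) by simp
qed

lemma pell_weighted_sum:
  "real (pell (n + 1)) = 1 / real (pell (k + 1)) *
     (\<Sum>i=0..n. (- (real (pell k) / real (pell (k + 1)))) ^ (n - i) * real (pell (i + (k + 1))))"
proof -
  define c where "c = real (pell (k + 1))"
  define r where "r = - (real (pell k) / c)"
  have c: "c \<noteq> 0"
    using pell_Suc_pos[of k] by (simp add: c_def)
  have step: "real (pell (Suc m + 1)) = r * real (pell (m + 1)) + real (pell (Suc m + (k + 1))) / c"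
    for m
  proof -
    have "real (pell (Suc m + (k + 1))) = c * real (pell (Suc m + 1)) + real (pell k) * real (pell (m + 1))"
      using arg_cong[OF pell_add[of "Suc m" k], of real] by (simp add: c_def)
    then show ?thesis
      using c by (simp add: r_def field_simps)
  qed
  have "real (pell (0 + 1)) = real (pell (0 + (k + 1))) / c"
    using c by (simp add: c_def)
  from linear_recurrence_solution[of "\<lambda>n. real (pell (n + 1))", OF this step]
  have "real (pell (n + 1)) = (\<Sum>i=0..n. r ^ (n - i) * (real (pell (i + (k + 1))) / c))" .
  also have "\<dots> = 1 / c * (\<Sum>i=0..n. r ^ (n - i) * real (pell (i + (k + 1))))"
    by (simp add: sum_divide_distrib)
  finally show ?thesis
    by (simp only: r_def c_def)
qed

theorem mainTheorem4:
  fixes n :: nat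
  shows "real (pell (n + 1)) = 1/2 * (\<Sum>i=0..n. (- (1/2)) ^ (n - i) * real (pell (i + 2)))
    \<and> 1/2 * (\<Sum>i=0..n. (- (1/2)) ^ (n - i) * real (pell (i + 2)))
        = 1/5 * (\<Sum>i=0..n. (- (2/5)) ^ (n - i) * real (pell (i + 3)))
    \<and> 1/5 * (\<Sum>i=0..n. (- (2/5)) ^ (n - i) * real (pell (i + 3)))
        = 1/12 * (\<Sum>i=0..n. (- (5/12)) ^ (n - i) * real (pell (i + 4)))"
proof -
  have p: "pell 1 = 1" "pell 2 = 2" "pell 3 = 5" "pell 4 = 12"
    by (simp_all add: numeral_eq_Suc)
  have k: "(1::nat) + 1 = 2" "(2::nat) + 1 = 3" "(3::nat) + 1 = 4"
    by simp_all
  note sums = pell_weighted_sum[of n 1, unfolded k p] pell_weighted_sum[of n 2, unfolded k p]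
    pell_weighted_sum[of n 3, unfolded k p]
  show ?thesis
    using sums by (simp only: of_nat_numeral of_nat_1)
qed

end
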